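(* Let $V$ be a countable set, and let $d$ be a metric on $\mathscr{G}(V)$ that metrizes the product topology. Let $\Sigma_{d,ball}$ be the $\sigma$-algebra on $\mathscr{G}(V)$ generated by the open $d$-balls (or, alternatively, by the closed $d$-balls). Then \[ \Sigma_{\rm meas} = \Sigma_{\mathscr{E},0} = \Sigma_{\mathscr{E}} = \Sigma_{d,ball} = \mathscr{B}_{\mathscr{G}(V)} = \Sigma_0. \]
   Context: For a set $V$ of labelled vertices, $K_V$ denotes the complete graph on $V$, identified with its edge set (the set of unordered pairs of distinct vertices). $\mathscr{G}(V)$ is the set of all graphs with vertex set $V$; each graph is identified with its edge set, so $\mathscr{G}(V) = \{0,1\}^{K_V}$, with the product topology. For disjoint $I_0, I_1 \subset K_V$, $\mathscr{E}(I_0,I_1) := \{G \in \mathscr{G}(V) : I_1 \subset G,\ I_0 \subset K_V \setminus G\}$. The following $\sigma$-algebras on $\mathscr{G}(V)$ are considered: $\Sigma_{\rm meas}$ is the product $\sigma$-algebra, generated by the cylinder sets $S_{e_0} := \{G \in \mathscr{G}(V) : e_0 \in G\}$, $e_0 \in K_V$; $\mathscr{B}_{\mathscr{G}(V)}$ is the Borel $\sigma$-algebra, generated by all open sets; $\Sigma_0$ is generated by all compact sets; $\Sigma_{\mathscr{E}}$ is generated by all sets $\mathscr{E}(I_0,I_1)$ with $I_0,I_1 \subset K_V$ disjoint; $\Sigma_{\mathscr{E},0}$ is generated by all $\mathscr{E}(I_0,I_1)$ with $I_0,I_1 \subset K_V$ finite (or, alternatively, countable) and disjoint. *)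

theory Defs
  imports "HOL-Analysis.Analysis"
begin

definition complete_graph :: "'v set \<Rightarrow> 'v set set" where
  "complete_graph V = {{u, v} | u v. u \<in> V \<and> v \<in> V \<and> u \<noteq> v}"

text \<open>A graph with vertex set \<open>V\<close> is identified with its edge set.\<close>

definition graphs :: "'v set \<Rightarrow> 'v set set set" where
  "graphs V = Pow (complete_graph V)"

text \<open>
  The identification of \<open>graphs V\<close> with \<open>{0,1}\<close>-valued families indexed by \<open>complete_graph V\<close>:
  a graph is sent to the indicator of its edge set. The topology on \<open>graphs V\<close> is the product
  of the discrete two-point topologies, transported along this bijection.
\<close>

definition edge_indicator :: "'v set \<Rightarrow> 'v set set \<Rightarrow> 'v set \<Rightarrow> bool" where
  "edge_indicator V G = (\<lambda>e\<in>complete_graph V. e \<in> G)"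

definition graph_topology :: "'v set \<Rightarrow> 'v set set topology" where
  "graph_topology V =
     pullback_topology (graphs V) (edge_indicator V)
       (product_topology (\<lambda>_. discrete_topology UNIV) (complete_graph V))"

lemma topspace_graph_topology [simp]: "topspace (graph_topology V) = graphs V"
  by (auto simp: graph_topology_def topspace_pullback_topology edge_indicator_def)

lemma bij_betw_edge_indicator:
  "bij_betw (edge_indicator V) (graphs V)
     (topspace (product_topology (\<lambda>_. discrete_topology UNIV) (complete_graph V)))"
proof (rule bij_betw_byWitness[where f' = "\<lambda>x. {e \<in> complete_graph V. x e}"])
  show "\<forall>G\<in>graphs V. {e \<in> complete_graph V. edge_indicator V G e} = G"
    by (auto simp: graphs_def edge_indicator_def)
qed (auto simp: graphs_def edge_indicator_def PiE_def extensional_def fun_eq_iff)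

definition edge_event :: "'v set \<Rightarrow> 'v set set \<Rightarrow> 'v set set \<Rightarrow> 'v set set set" where
  "edge_event V I0 I1 = {G \<in> graphs V. I1 \<subseteq> G \<and> I0 \<subseteq> complete_graph V - G}"

definition Sigma_meas :: "'v set \<Rightarrow> 'v set set set set" where
  "Sigma_meas V =
     sigma_sets (graphs V) {{G \<in> graphs V. e \<in> G} | e. e \<in> complete_graph V}"

definition Sigma_Borel :: "'v set \<Rightarrow> 'v set set set set" where
  "Sigma_Borel V = sigma_sets (graphs V) {U. openin (graph_topology V) U}"

definition Sigma_compact :: "'v set \<Rightarrow> 'v set set set set" where
  "Sigma_compact V = sigma_sets (graphs V) {C. compactin (graph_topology V) C}"

definition Sigma_event :: "'v set \<Rightarrow> 'v set set set set" where
  "Sigma_event V =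
     sigma_sets (graphs V)
       {edge_event V I0 I1 | I0 I1.
          I0 \<subseteq> complete_graph V \<and> I1 \<subseteq> complete_graph V \<and> I0 \<inter> I1 = {}}"

definition Sigma_event_finite :: "'v set \<Rightarrow> 'v set set set set" where
  "Sigma_event_finite V =
     sigma_sets (graphs V)
       {edge_event V I0 I1 | I0 I1.
          I0 \<subseteq> complete_graph V \<and> I1 \<subseteq> complete_graph V \<and> I0 \<inter> I1 = {} \<and>
          finite I0 \<and> finite I1}"

definition Sigma_event_countable :: "'v set \<Rightarrow> 'v set set set set" where
  "Sigma_event_countable V =
     sigma_sets (graphs V)
       {edge_event V I0 I1 | I0 I1.
          I0 \<subseteq> complete_graph V \<and> I1 \<subseteq> complete_graph V \<and> I0 \<inter> I1 = {} \<and>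
          countable I0 \<and> countable I1}"

definition Sigma_ball ::
    "'v set \<Rightarrow> ('v set set \<Rightarrow> 'v set set \<Rightarrow> real) \<Rightarrow> 'v set set set set" where
  "Sigma_ball V d =
     sigma_sets (graphs V) {Metric_space.mball (graphs V) d G r | G r. G \<in> graphs V \<and> r > 0}"

definition Sigma_cball ::
    "'v set \<Rightarrow> ('v set set \<Rightarrow> 'v set set \<Rightarrow> real) \<Rightarrow> 'v set set set set" where
  "Sigma_cball V d =
     sigma_sets (graphs V) {Metric_space.mcball (graphs V) d G r | G r. G \<in> graphs V \<and> r > 0}"

end

theory Submission
  imports Defs
begin

text \<open>
  The graphs agreeing with \<open>G\<close> on a finite edge set form an elementary event contained in any
  prescribed neighbourhood of \<open>G\<close>; there are countably many such events, so every open set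
  is a countable union of them. The finite graphs form a countable dense set, so every open
  set is also a countable union of balls of radius \<open>1 / n\<close>. Finally, \<open>{0,1}\<close>-valued families form a
  compact Hausdorff space, in which compact and closed sets coincide.
\<close>

lemma countable_complete_graph:
  assumes "countable V" shows "countable (complete_graph V)"
proof -
  have "complete_graph V \<subseteq> (\<lambda>(u, v). {u, v}) ` (V \<times> V)"
    by (auto simp: complete_graph_def)
  then show ?thesis
    by (rule countable_subset) (use assms in auto)
qed

text \<open>The cylinder is the preimage of the open set \<open>{True}\<close> under the projection
  to coordinate \<open>e\<close>.\<close>

lemma openin_edge_cylinder:
  assumes "e \<in> complete_graph V"
  shows "openin (graph_topology V) {G \<in> graphs V. e \<in> G}"
proof -
  let ?X = "product_topology (\<lambda>_. discrete_topology (UNIV :: bool set)) (complete_graph V)"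
  have "openin ?X {x \<in> topspace ?X. x e \<in> {True}}"
    using assms by (intro openin_continuous_map_preimage[OF continuous_map_product_projection]) auto
  moreover have "{G \<in> graphs V. e \<in> G} =
      edge_indicator V -` {x \<in> topspace ?X. x e \<in> {True}} \<inter> graphs V"
    using assms by (auto simp: edge_indicator_def)
  ultimately show ?thesis
    unfolding graph_topology_def openin_pullback_topology by blast
qed

text \<open>A basic box of the product topology restricts only finitely many coordinates. Taking
  \<open>F\<close> to be these coordinates, agreement with \<open>G\<close> on \<open>F\<close>
  already forces a graph into the box.\<close>

lemma graph_topology_base:
  assumes "openin (graph_topology V) U" and "G \<in> U"
  obtains F where "finite F" "F \<subseteq> complete_graph V" "edge_event V (F - G) (F \<inter> G) \<subseteq> U"
proof -
  let ?X = "product_topology (\<lambda>_. discrete_topology (UNIV :: bool set)) (complete_graph V)"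
  obtain W where W: "openin ?X W" and U: "U = edge_indicator V -` W \<inter> graphs V"
    using assms(1) unfolding graph_topology_def openin_pullback_topology by blast
  have "edge_indicator V G \<in> W" using assms(2) U by simp
  then obtain T where fin: "finite {e \<in> complete_graph V. T e \<noteq> UNIV}"
    and in_T: "edge_indicator V G \<in> Pi\<^sub>E (complete_graph V) T"
    and sub: "Pi\<^sub>E (complete_graph V) T \<subseteq> W"
    using W unfolding openin_product_topology_alt by auto
  let ?F = "{e \<in> complete_graph V. T e \<noteq> UNIV}"
  have "H \<in> U" if H: "H \<in> edge_event V (?F - G) (?F \<inter> G)" for H
  proof -
    have "edge_indicator V H e \<in> T e" if e: "e \<in> complete_graph V" for e
    proof (cases "T e = UNIV")
      case False
      then have "e \<in> H \<longleftrightarrow> e \<in> G"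
        using H e by (auto simp: edge_event_def)
      then show ?thesis
        using in_T e by (auto simp: edge_indicator_def PiE_iff)
    qed simp
    then have "edge_indicator V H \<in> Pi\<^sub>E (complete_graph V) T"
      by (auto simp: PiE_iff edge_indicator_def)
    then show ?thesis using sub U H by (auto simp: edge_event_def)
  qed
  with fin show ?thesis by (intro that[of ?F]) auto
qed

text \<open>By Tychonoff the product of two-point spaces is compact, and \<open>g\<close>, the
  inverse of \<open>edge_indicator V\<close>, maps it continuously onto the graphs.\<close>

lemma compact_space_graph_topology: "compact_space (graph_topology V)"
proof -
  let ?X = "product_topology (\<lambda>_. discrete_topology (UNIV :: bool set)) (complete_graph V)"
  define g where "g = (\<lambda>x. {e \<in> complete_graph V. x e})"
  have inv: "edge_indicator V (g x) = x" if "x \<in> topspace ?X" for x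
    using that by (auto simp: edge_indicator_def g_def PiE_iff extensional_def fun_eq_iff)
  \<comment> \<open>Continuity into a pullback topology is tested after composing with
    \<open>edge_indicator V\<close>, and that composite is the identity on the product.\<close>
  have "continuous_map ?X ?X (edge_indicator V \<circ> g)"
    by (rule continuous_map_eq[OF continuous_map_id]) (simp only: inv id_apply comp_apply)
  then have cont: "continuous_map ?X (graph_topology V) g"
    unfolding graph_topology_def
    by (rule continuous_map_pullback') (auto simp: g_def graphs_def)
  have "g ` topspace ?X = graphs V"
  proof
    show "g ` topspace ?X \<subseteq> graphs V"
      by (auto simp: g_def graphs_def)
    show "graphs V \<subseteq> g ` topspace ?X"
    proof
      fix G assume "G \<in> graphs V"
      then show "G \<in> g ` topspace ?X"
        by (intro image_eqI[of _ _ "edge_indicator V G"])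
          (auto simp: g_def graphs_def edge_indicator_def)
    qed
  qed
  moreover have "compactin ?X (topspace ?X)"
    unfolding compact_space_def[symmetric] compact_space_product_topology
    by (simp add: compact_space_discrete_topology)
  ultimately show ?thesis
    using image_compactin[OF _ cont] by (metis compact_space_def topspace_graph_topology)
qed

text \<open>This family serves twice: its pairs index the elementary events with finite edge sets,
  and its members are the centres of the balls.\<close>

definition finite_graphs :: "'v set \<Rightarrow> 'v set set set" where
  "finite_graphs V = {F. finite F \<and> F \<subseteq> complete_graph V}"

lemma countable_finite_graphs: "countable V \<Longrightarrow> countable (finite_graphs V)"
  unfolding finite_graphs_def
  by (rule countable_Collect_finite_subset[OF countable_complete_graph])

lemma finite_graphs_dense: "graph_topology V closure_of finite_graphs V = graphs V"
proof -
  have "\<exists>F\<in>finite_graphs V. F \<in> U" if U: "openin (graph_topology V) U" "G \<in> U" for G U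
  proof -
    obtain F where F: "finite F" "F \<subseteq> complete_graph V"
      "edge_event V (F - G) (F \<inter> G) \<subseteq> U"
      using graph_topology_base[OF U] .
    \<comment> \<open>Truncating \<open>G\<close> to \<open>F\<close> leaves a finite graph that
      still agrees with \<open>G\<close> on \<open>F\<close>.\<close>
    then have "F \<inter> G \<in> edge_event V (F - G) (F \<inter> G)"
      by (auto simp: edge_event_def graphs_def)
    with F show ?thesis by (auto simp: finite_graphs_def)
  qed
  then show ?thesis unfolding closure_of_def by auto
qed

lemma openin_in_sigma_finite_events:
  assumes "countable V" "openin (graph_topology V) U"
  shows "U \<in> Sigma_event_finite V"
proof -
  let ?P = "finite_graphs V \<times> finite_graphs V"
  \<comment> \<open>Indexing by all pairs of finite edge sets whose event fits into
    \<open>U\<close>, instead of by the points of \<open>U\<close>, keeps the union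
    countable.\<close>
  let ?C = "{(I0, I1) \<in> ?P. I0 \<inter> I1 = {} \<and> edge_event V I0 I1 \<subseteq> U}"
  have "U = (\<Union>(I0, I1)\<in>?C. edge_event V I0 I1)"
  proof (intro equalityI subsetI)
    fix G assume G: "G \<in> U"
    then obtain F where F: "finite F" "F \<subseteq> complete_graph V"
      "edge_event V (F - G) (F \<inter> G) \<subseteq> U"
      using graph_topology_base[OF assms(2)] by blast
    have "G \<in> graphs V"
      using G openin_subset[OF assms(2)] by auto
    then have "G \<in> edge_event V (F - G) (F \<inter> G)"
      using F by (auto simp: edge_event_def)
    moreover have "(F - G, F \<inter> G) \<in> ?C"
      using F by (auto simp: finite_graphs_def)
    ultimately show "G \<in> (\<Union>(I0, I1)\<in>?C. edge_event V I0 I1)" by blast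
  qed auto
  moreover have "countable ?C"
    by (rule countable_subset[of _ ?P]) (use assms(1) in \<open>auto intro: countable_finite_graphs\<close>)
  have "edge_event V I0 I1 \<in> Sigma_event_finite V" if "(I0, I1) \<in> ?C" for I0 I1
    unfolding Sigma_event_finite_def
    by (rule sigma_sets.Basic) (use that in \<open>auto simp: finite_graphs_def\<close>)
  then have "(\<Union>(I0, I1)\<in>?C. edge_event V I0 I1) \<in> Sigma_event_finite V"
    unfolding Sigma_event_finite_def
    by (intro sigma_sets_UNION countable_image \<open>countable ?C\<close>) auto
  ultimately show ?thesis by simp
qed

text \<open>Countability of \<open>V\<close> makes every edge set countable, so even for infinite
  \<open>I0\<close> and \<open>I1\<close> the event is a countable intersection of cylinders and
  their complements.\<close>

lemma edge_event_in_Sigma_meas: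
  assumes "countable V" "I0 \<subseteq> complete_graph V" "I1 \<subseteq> complete_graph V"
  shows "edge_event V I0 I1 \<in> Sigma_meas V"
proof -
  let ?S = "\<lambda>e. {G \<in> graphs V. e \<in> G}"
  interpret sigma_algebra "graphs V" "Sigma_meas V"
    unfolding Sigma_meas_def by (rule sigma_algebra_sigma_sets) auto
  have S: "?S e \<in> Sigma_meas V" if "e \<in> complete_graph V" for e
    unfolding Sigma_meas_def by (rule sigma_sets.Basic) (use that in auto)
  have I: "countable I0" "countable I1"
    using assms(2,3) countable_complete_graph[OF assms(1)] by (auto intro: countable_subset)
  have "{G \<in> graphs V. \<forall>e\<in>I0. e \<notin> G} \<in> Sigma_meas V"
    using S assms(2) by (intro sets_Collect_countable_All' sets_Collect_neg I) auto
  moreover have "{G \<in> graphs V. \<forall>e\<in>I1. e \<in> G} \<in> Sigma_meas V"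
    using S assms(3) by (intro sets_Collect_countable_All' I) auto
  moreover have "edge_event V I0 I1 =
      {G \<in> graphs V. \<forall>e\<in>I0. e \<notin> G} \<inter> {G \<in> graphs V. \<forall>e\<in>I1. e \<in> G}"
    using assms by (auto simp: edge_event_def)
  ultimately show ?thesis by auto
qed

text \<open>The family \<open>B\<close> is only required to lie between the open and the closed
  balls, so that one argument covers both kinds of generators.\<close>

lemma (in Metric_space) openin_in_sigma_sets_balls:
  assumes U: "openin mtopology U" and D: "countable D" "mtopology closure_of D = M"
    and B: "\<And>x r. x \<in> M \<Longrightarrow> r > 0 \<Longrightarrow> B x r \<in> \<B>"
    and ball_sub: "\<And>x r. mball x r \<subseteq> B x r" and sub_cball: "\<And>x r. B x r \<subseteq> mcball x r"
  shows "U \<in> sigma_sets M \<B>"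
proof -
  let ?r = "\<lambda>n. inverse (real (Suc n))"
  \<comment> \<open>Centres are restricted to \<open>M\<close> because \<open>B x r\<close> is
    assumed to be in \<B> only for such \<open>x\<close>.\<close>
  let ?C = "{(x, n). x \<in> D \<inter> M \<and> B x (?r n) \<subseteq> U}"
  have "U = (\<Union>(x, n)\<in>?C. B x (?r n))"
  proof (intro equalityI subsetI)
    fix y assume y: "y \<in> U"
    then obtain r where r: "r > 0" "mball y r \<subseteq> U"
      using U by (auto simp: openin_mtopology)
    have "y \<in> M" using y U by (auto simp: openin_mtopology)
    \<comment> \<open>Half of \<open>r\<close> suffices: for \<open>z\<close> in
      \<open>mcball x (?r n)\<close>, the distance from \<open>y\<close> to \<open>z\<close> is at
      most that from \<open>y\<close> to \<open>x\<close> plus that from \<open>x\<close> to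
      \<open>z\<close>, hence less than \<open>2 * ?r n < r\<close>.\<close>
    obtain n where n: "?r n < r / 2"
      using reals_Archimedean[of "r / 2"] r by auto
    have "y \<in> mtopology closure_of D" using D \<open>y \<in> M\<close> by simp
    moreover have "y \<in> mball y (?r n)" using \<open>y \<in> M\<close> by simp
    ultimately obtain x where x: "x \<in> D" "x \<in> mball y (?r n)"
      unfolding in_closure_of using openin_mball by blast
    have "mcball x (?r n) \<subseteq> mball y r"
    proof
      fix z assume "z \<in> mcball x (?r n)"
      then show "z \<in> mball y r"
        using x n triangle[of y x z] by auto
    qed
    then have "(x, n) \<in> ?C"
      using x r sub_cball[of x "?r n"] by auto
    moreover have "y \<in> B x (?r n)"
      using x ball_sub[of x "?r n"] by (auto simp: commute)
    ultimately show "y \<in> (\<Union>(x, n)\<in>?C. B x (?r n))" by blast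
  qed auto
  moreover have "countable ?C"
    by (rule countable_subset[of _ "D \<times> UNIV"]) (use D(1) in auto)
  then have "(\<Union>(x, n)\<in>?C. B x (?r n)) \<in> sigma_sets M \<B>"
    using B by (intro sigma_sets_UNION countable_image) (auto intro!: sigma_sets.Basic)
  ultimately show ?thesis by simp
qed

text \<open>This brings closed balls and compact sets into the Borel sigma-algebra.\<close>

lemma closedin_in_Sigma_Borel:
  assumes "closedin (graph_topology V) C"
  shows "C \<in> Sigma_Borel V"
proof -
  have "graphs V - (graphs V - C) \<in> Sigma_Borel V"
    unfolding Sigma_Borel_def
    using assms by (intro sigma_sets.Compl sigma_sets.Basic) (auto simp: closedin_def)
  moreover have "graphs V - (graphs V - C) = C"
    using closedin_subset[OF assms] by auto
  ultimately show ?thesis by simp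
qed

theorem theorem2p4:
  fixes V :: "'v set" and d :: "'v set set \<Rightarrow> 'v set set \<Rightarrow> real"
  assumes "countable V"
    and "Metric_space (graphs V) d"
    and "Metric_space.mtopology (graphs V) d = graph_topology V"
  shows "Sigma_meas V = Sigma_event_finite V
    \<and> Sigma_event_finite V = Sigma_event_countable V
    \<and> Sigma_event_countable V = Sigma_event V
    \<and> Sigma_event V = Sigma_ball V d
    \<and> Sigma_ball V d = Sigma_cball V d
    \<and> Sigma_cball V d = Sigma_Borel V
    \<and> Sigma_Borel V = Sigma_compact V"
proof -
  interpret Metric_space "graphs V" d by fact
  note top = assms(3)
  have dense: "countable (finite_graphs V)" "mtopology closure_of finite_graphs V = graphs V"
    using countable_finite_graphs[OF assms(1)] finite_graphs_dense top by auto
  \<comment> \<open>The first five inclusions form a cycle through the three event algebras,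
    \<open>Sigma_meas V\<close> and \<open>Sigma_Borel V\<close>. The ball and compact algebras are
    then each compared with \<open>Sigma_Borel V\<close> in both directions.\<close>
  have "Sigma_event_finite V \<subseteq> Sigma_event_countable V"
    unfolding Sigma_event_finite_def Sigma_event_countable_def
    by (rule sigma_sets_mono') (auto intro: countable_finite)
  moreover have "Sigma_event_countable V \<subseteq> Sigma_event V"
    unfolding Sigma_event_countable_def Sigma_event_def
    by (rule sigma_sets_mono') auto
  moreover have "Sigma_event V \<subseteq> Sigma_meas V"
    using edge_event_in_Sigma_meas[OF assms(1)]
    unfolding Sigma_event_def Sigma_meas_def by (intro sigma_sets_mono) auto
  moreover have "Sigma_meas V \<subseteq> Sigma_Borel V"
    unfolding Sigma_meas_def Sigma_Borel_def
    by (rule sigma_sets_mono') (auto intro: openin_edge_cylinder)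
  moreover have "Sigma_Borel V \<subseteq> Sigma_event_finite V"
    using openin_in_sigma_finite_events[OF assms(1)]
    unfolding Sigma_Borel_def Sigma_event_finite_def by (intro sigma_sets_mono) auto
  moreover have "Sigma_Borel V \<subseteq> Sigma_ball V d"
    unfolding Sigma_Borel_def Sigma_ball_def
  proof (intro sigma_sets_mono subsetI, clarify)
    fix U assume "openin (graph_topology V) U"
    then show "U \<in> sigma_sets (graphs V) {mball G r | G r. G \<in> graphs V \<and> r > 0}"
      by (intro openin_in_sigma_sets_balls[OF _ dense, where B = mball])
        (auto simp: top mball_subset_mcball)
  qed
  moreover have "Sigma_Borel V \<subseteq> Sigma_cball V d"
    unfolding Sigma_Borel_def Sigma_cball_def
  proof (intro sigma_sets_mono subsetI, clarify)
    fix U assume "openin (graph_topology V) U"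
    then show "U \<in> sigma_sets (graphs V) {mcball G r | G r. G \<in> graphs V \<and> r > 0}"
      by (intro openin_in_sigma_sets_balls[OF _ dense, where B = mcball])
        (auto simp: top mball_subset_mcball)
  qed
  moreover have "Sigma_ball V d \<subseteq> Sigma_Borel V"
    unfolding Sigma_ball_def Sigma_Borel_def
    using openin_mball top by (intro sigma_sets_mono') auto
  moreover have "Sigma_cball V d \<subseteq> Sigma_Borel V"
    using closedin_in_Sigma_Borel closedin_mcball top
    unfolding Sigma_cball_def Sigma_Borel_def by (intro sigma_sets_mono) auto
  \<comment> \<open>Compact sets are closed since the topology comes from the metric
    \<open>d\<close> and is therefore Hausdorff.\<close>
  moreover have "Sigma_compact V \<subseteq> Sigma_Borel V"
    using closedin_in_Sigma_Borel compactin_imp_closedin[OF Hausdorff_space_mtopology] top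
    unfolding Sigma_compact_def Sigma_Borel_def by (intro sigma_sets_mono) auto
  moreover have "Sigma_Borel V \<subseteq> Sigma_compact V"
    unfolding Sigma_compact_def Sigma_Borel_def
  proof (intro sigma_sets_mono subsetI, clarify)
    fix U assume U: "openin (graph_topology V) U"
    \<comment> \<open>The complement of an open set is closed in a compact space, hence a generator
      of \<open>Sigma_compact V\<close>; complementing again recovers \<open>U\<close>.\<close>
    then have "compactin (graph_topology V) (graphs V - U)"
      by (intro closedin_compact_space[OF compact_space_graph_topology])
        (metis closedin_diff closedin_topspace topspace_graph_topology)
    then have "graphs V - (graphs V - U) \<in> sigma_sets (graphs V) {C. compactin (graph_topology V) C}"
      by (intro sigma_sets.Compl sigma_sets.Basic) auto
    moreover have "graphs V - (graphs V - U) = U"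
      using openin_subset[OF U] by auto
    ultimately show "U \<in> sigma_sets (graphs V) {C. compactin (graph_topology V) C}" by simp
  qed
  ultimately show ?thesis by blast
qed

end
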